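(* For all integers $n\ge1$ and all $A\subset\{0,1\}^n$, \[ \mathbf{E}\sqrt{h_A}\ \ge\ |A|\sqrt{\log_2(1/|A|)+1}-|A|, \] and as a consequence \[ \mathcal{B}_{\frac12}(x)\sim x\sqrt{\log_2(1/x)}\quad\text{as } x\to 0^+, \] where $x$ ranges over dyadic rationals in $(0,1)$.
   Context: The Hamming cube $\{0,1\}^n$ is viewed as a graph in which two vertices are joined by an edge iff they differ in exactly one coordinate. For $A\subset\{0,1\}^n$ and $x\in A$, $h_A(x)$ is the number of edges connecting $x$ with the complement of $A$; $h_A(x)=0$ if $x\notin A$. For $f:\{0,1\}^n\to\mathbb{R}$, $\mathbf{E}f=2^{-n}\sum_{x}f(x)$, and $|A|=\mathbf{E}\mathbf{1}_A=2^{-n}\#A$. The right-hand side of the first inequality is read as $0$ when $|A|=0$. For a dyadic rational $x\in\mathcal{Q}=\{k2^{-n}: n\ge 0,\ 0\le k\le 2^n\}$, \[ \mathcal{B}_{\frac12}(x)=\inf_{n\ge 1}\ \inf_{A\subset\{0,1\}^n,\ |A|=x}\mathbf{E}\sqrt{h_A}. \] $f(x)\sim g(x)$ as $x\to x_*$ means $\lim_{x\to x_*}f(x)/g(x)=1$. *)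

theory Defs
  imports "HOL-Analysis.Analysis"
begin

definition cube :: "nat \<Rightarrow> (nat \<Rightarrow> nat) set" where
  "cube n = {..<n} \<rightarrow>\<^sub>E {0, 1}"

definition cube_adj :: "nat \<Rightarrow> (nat \<Rightarrow> nat) \<Rightarrow> (nat \<Rightarrow> nat) \<Rightarrow> bool" where
  "cube_adj n x y \<longleftrightarrow> x \<in> cube n \<and> y \<in> cube n \<and> card {i \<in> {..<n}. x i \<noteq> y i} = 1"

text \<open>The cube is a simple graph, so edges from \<open>x\<close> to the complement of \<open>A\<close>
  are counted by their endpoints outside \<open>A\<close>.\<close>

definition edge_boundary :: "nat \<Rightarrow> (nat \<Rightarrow> nat) set \<Rightarrow> (nat \<Rightarrow> nat) \<Rightarrow> nat" where
  "edge_boundary n A x = (if x \<in> A then card {y \<in> cube n - A. cube_adj n x y} else 0)"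

definition cube_expectation :: "nat \<Rightarrow> ((nat \<Rightarrow> nat) \<Rightarrow> real) \<Rightarrow> real" where
  "cube_expectation n f = (\<Sum>x\<in>cube n. f x) / 2 ^ n"

definition cube_measure :: "nat \<Rightarrow> (nat \<Rightarrow> nat) set \<Rightarrow> real" where
  "cube_measure n A = cube_expectation n (indicat_real A)"

lemma cube_measure_eq_card:
  assumes "A \<subseteq> cube n"
  shows "cube_measure n A = card A / 2 ^ n"
proof -
  have "finite (cube n)"
    by (simp add: cube_def finite_PiE)
  then show ?thesis
    using assms by (simp add: cube_measure_def cube_expectation_def Int_absorb1 sum.If_cases indicator_def)
qed

definition dyadic_unit :: "real set" where
  "dyadic_unit = {real k / 2 ^ n | k n :: nat. k \<le> 2 ^ n}"

text \<open>A single infimum over all pairs \<open>(n, A)\<close>: not every \<open>n\<close> admits a set of measure \<open>x\<close>,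
  and nested real-valued infima would give the inner empty ones an unspecified value instead
  of infinity. For \<open>x\<close> in \<open>dyadic_unit\<close> the set below is nonempty and bounded below by 0.\<close>

definition B_half :: "real \<Rightarrow> real" where
  "B_half x = Inf {cube_expectation n (\<lambda>v. sqrt (real (edge_boundary n A v))) | n A.
                     n \<ge> 1 \<and> A \<subseteq> cube n \<and> cube_measure n A = x}"

end

theory Submission
  imports Defs "HOL-Real_Asymp.Real_Asymp"
begin

text \<open>The lower bound is proved by induction on the dimension. Cutting the cube along its last coordinate
splits \<open>A\<close> into two slices of measures \<open>x \<le> y\<close>, and each point of the larger slice whose neighbour is not in the
smaller one gains an edge; there are at least \<open>y - x\<close> such points in measure. By the Minkowski inequality
(\<open>minkowski_sqrt\<close>, \<open>half_boundary_extra\<close>) the larger slice therefore contributes at least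
\<open>sqrt (b\<^sup>2 + (y - x)\<^sup>2)\<close>, where \<open>b\<close> is its own half boundary. The induction closes
(\<open>half_boundary_ge_profile\<close>) because the bounding function \<open>profile\<close> satisfies the two-point inequality
\<open>2 * profile ((x + y) / 2) \<le> profile x + sqrt ((profile y)\<^sup>2 + (y - x)\<^sup>2)\<close>.

The two-point inequality (\<open>profile_two_point\<close>) loses its subtracted linear terms by one application of the
triangle inequality in the plane. What is left depends on \<open>t = x / y\<close> and on \<open>\<sigma> = 1 + log 2 (1 / y) \<ge> 1\<close>, and
it is enough to treat \<open>\<sigma> = 1\<close> (\<open>two_point_all_scales\<close>). The resulting inequality in the single variable \<open>t\<close>
is an equality at \<open>t = 0\<close> and has a double zero at \<open>t = 1\<close>; the half \<open>t \<le> 1/2\<close> follows from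
linear bounds on the logarithms, and the half \<open>t \<ge> 1/2\<close> from a bound on a second derivative.

For the asymptotics, every dyadic \<open>x\<close> is the measure of a lexicographic initial segment, whose mean boundary
is at most \<open>x * (log 2 (1 / x) + 2)\<close> (\<open>exists_small_mean_boundary\<close>). By Cauchy--Schwarz its half boundary is
at most \<open>x * sqrt (log 2 (1 / x) + 2)\<close>, so \<open>B_half x\<close> lies between two expressions that are
both asymptotic to \<open>x * sqrt (log 2 (1 / x))\<close>.\<close>

section \<open>The two-point inequality\<close>

definition profile :: "real \<Rightarrow> real" where
  "profile x = x * sqrt (log 2 (1 / x) + 1) - x"

lemma inverse_ln2_bounds: "36 / 25 \<le> 1 / ln (2::real)" "1 / ln (2::real) \<le> 3 / 2"
  using ln2_le_25_over_36 ln2_ge_two_thirds by (auto simp: field_simps)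

text \<open>The tangent of \<open>log 2 (1 / t)\<close> at \<open>1\<close>, with its slope \<open>1 / ln 2\<close> rounded to a rational.\<close>
lemma log2_inverse_ge_linear: fixes t :: real assumes "0 < t" "t \<le> 1"
  shows "36/25 * (1 - t) \<le> log 2 (1/t)"
proof -
  have "1 - t \<le> - ln t" using ln_le_minus_one[of t] assms by simp
  then have "(1 - t) * (36/25) \<le> (- ln t) * (1 / ln 2)"
    using inverse_ln2_bounds assms by (intro mult_mono) auto
  then show ?thesis using assms by (simp add: log_def ln_div)
qed

text \<open>The geometric mean grows at least as fast as a common shift of its two arguments:
  after squaring, this is the inequality between arithmetic and geometric means.\<close>
lemma geometric_mean_shift:
  fixes a p \<sigma> :: real
  assumes "0 \<le> a" "0 \<le> p" "1 \<le> \<sigma>"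
  shows "sqrt (1 + p) * sqrt (1 + a) + (\<sigma> - 1) \<le> sqrt (\<sigma> + p) * sqrt (\<sigma> + a)"
proof -
  define u v where "u = sqrt (1 + p)" and "v = sqrt (1 + a)"
  have sq: "u\<^sup>2 = 1 + p" "v\<^sup>2 = 1 + a" using assms by (auto simp: u_def v_def)
  have "0 \<le> (\<sigma> - 1) * (u - v)\<^sup>2" using assms by simp
  then have "(u * v + (\<sigma> - 1))\<^sup>2 \<le> (u\<^sup>2 + (\<sigma> - 1)) * (v\<^sup>2 + (\<sigma> - 1))"
    by (simp add: power2_eq_square algebra_simps)
  then have "u * v + (\<sigma> - 1) \<le> sqrt ((\<sigma> + p) * (\<sigma> + a))"
    by (intro real_le_rsqrt) (simp add: sq add.commute)
  then show ?thesis by (simp add: u_def v_def real_sqrt_mult)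
qed

text \<open>Multiplied by \<open>sqrt (\<sigma> + a)\<close>, every term of the claim becomes a geometric mean of numbers
  shifted by \<open>\<sigma> - 1\<close>, while \<open>(1 + t) * (\<sigma> + a)\<close> grows by exactly \<open>(1 + t) * (\<sigma> - 1)\<close>. So the inequality
  at \<open>\<sigma> = 1\<close> implies it at every larger \<open>\<sigma>\<close>.\<close>
lemma two_point_all_scales:
  fixes a b q t \<sigma> :: real
  assumes "0 \<le> a" "0 \<le> b" "0 \<le> q" "0 \<le> t" "1 \<le> \<sigma>"
    and base: "(1 + t) * sqrt (1 + a) \<le> t * sqrt (1 + b) + sqrt (1 + q)"
  shows "(1 + t) * sqrt (\<sigma> + a) \<le> t * sqrt (\<sigma> + b) + sqrt (\<sigma> + q)"
proof -
  have sq: "sqrt (1 + a) * sqrt (1 + a) = 1 + a" "sqrt (\<sigma> + a) * sqrt (\<sigma> + a) = \<sigma> + a"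
    using assms by auto
  have "(1 + t) * (1 + a) \<le> t * (sqrt (1 + b) * sqrt (1 + a)) + sqrt (1 + q) * sqrt (1 + a)"
    using mult_right_mono[OF base, of "sqrt (1 + a)"] assms sq by (simp add: algebra_simps)
  then have "(1 + t) * (\<sigma> + a)
      \<le> t * (sqrt (1 + b) * sqrt (1 + a) + (\<sigma> - 1)) + (sqrt (1 + q) * sqrt (1 + a) + (\<sigma> - 1))"
    by (simp add: algebra_simps)
  also have "\<dots> \<le> t * (sqrt (\<sigma> + b) * sqrt (\<sigma> + a)) + sqrt (\<sigma> + q) * sqrt (\<sigma> + a)"
    using assms by (intro add_mono mult_left_mono geometric_mean_shift) auto
  finally have "sqrt (\<sigma> + a) * ((1 + t) * sqrt (\<sigma> + a))
      \<le> sqrt (\<sigma> + a) * (t * sqrt (\<sigma> + b) + sqrt (\<sigma> + q))"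
    using sq(2) by (simp add: algebra_simps)
  moreover have "0 < sqrt (\<sigma> + a)" using assms by simp
  ultimately show ?thesis by simp
qed

text \<open>Both sides agree at \<open>t = 0\<close>. For \<open>t \<le> 1/2\<close> the left-hand side is replaced by
  \<open>P = (1 + t) * sqrt (2 - 7/6 * t)\<close>, using the chord of the concave function \<open>log 2 (1 + t)\<close> between
  \<open>0\<close> and \<open>1/2\<close>. With \<open>Q = sqrt (1 + (1 - t)\<^sup>2)\<close>, the difference of squares \<open>P\<^sup>2 - Q\<^sup>2 = t * N\<close> has a factor \<open>t\<close>,
  so it remains to bound \<open>N / (P + Q)\<close> by \<open>sqrt (1 + log 2 (1 / t))\<close>; linear bounds for \<open>P\<close>, \<open>Q\<close>, \<open>N\<close>
  and the logarithm suffice for this.\<close>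
lemma two_point_unit_small:
  fixes t :: real
  assumes t: "0 < t" "t \<le> 1/2"
  shows "(1 + t) * sqrt (1 + log 2 (2 / (1 + t))) \<le> t * sqrt (1 + log 2 (1 / t)) + sqrt (1 + (1 - t)\<^sup>2)"
proof -
  have l32: "7/12 \<le> log 2 (3/2 :: real)"
  proof -
    \<comment> \<open>\<open>7/12\<close> arises because \<open>(3/2) ^ 12\<close> is slightly larger than \<open>2 ^ 7\<close>.\<close>
    have "log 2 (2 ^ 7) \<le> log 2 ((3/2 :: real) ^ 12)"
      by (subst log_le_cancel_iff) (auto simp: power_divide)
    then show ?thesis using log_nat_power[of 2 2 7] log_nat_power[of "3/2" 2 12] by simp
  qed
  have conc: "concave_on {0<..} (log (2::real))"
    by (intro log_concave) simp
  have "7/6 * t \<le> log 2 (1 + t)"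
  proof -
    have "(1 - 2*t) * log 2 1 + (2*t) * log 2 (3/2) \<le> log 2 ((1 - 2*t) *\<^sub>R 1 + (2*t) *\<^sub>R (3/2))"
      using t by (intro concave_onD[OF conc]) auto
    moreover have "2 * t * (7/12) \<le> 2 * t * log 2 (3/2)" using t l32 by (intro mult_left_mono) auto
    ultimately show ?thesis by (simp add: algebra_simps)
  qed
  then have a: "1 + log 2 (2 / (1 + t)) \<le> 2 - 7/6 * t"
    using t by (simp add: log_divide)
  \<comment> \<open>Apart from the rounding of \<open>1 / ln 2\<close>, the tangent at \<open>t = 1/2\<close>.\<close>
  have b: "86/25 - 72/25 * t \<le> 1 + log 2 (1 / t)"
    using log2_inverse_ge_linear[of "2*t"] t by (simp add: log_divide log_mult)
  define P where "P = (1 + t) * sqrt (2 - 7/6 * t)"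
  define Q where "Q = sqrt (1 + (1 - t)\<^sup>2)"
  define N where "N = 29/6 - 4/3 * t - 7/6 * t\<^sup>2"
  have P2: "P\<^sup>2 = (1 + t)\<^sup>2 * (2 - 7/6 * t)" using t by (simp add: P_def power_mult_distrib)
  have Q2: "Q\<^sup>2 = 1 + (1 - t)\<^sup>2" by (simp add: Q_def)
  have t2: "t\<^sup>2 \<le> t/2" "t^3 \<le> t/4" "0 \<le> t\<^sup>2"
  proof -
    show "t\<^sup>2 \<le> t/2" using t by (simp add: power2_eq_square)
    have "t * t\<^sup>2 \<le> t * (1/2)\<^sup>2" using t by (intro mult_left_mono power_mono) auto
    then show "t^3 \<le> t/4" by (simp add: power2_eq_square power3_eq_cube)
  qed simp
  \<comment> \<open>At \<open>t = 0\<close> both \<open>P\<close> and \<open>Q\<close> equal \<open>sqrt 2\<close>, for which \<open>141/100\<close> stands; the slopes \<open>7/10\<close> and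
    \<open>- 7/10\<close> are chosen to cancel in \<open>P + Q\<close>.\<close>
  have "141/100 + 7/10 * t \<le> P"
  proof (rule power2_le_imp_le)
    have "(141/100 + 7/10 * t)\<^sup>2 = 19881/10000 + 987/500 * t + 49/100 * t\<^sup>2"
      by (simp add: power2_eq_square field_simps)
    also have "\<dots> \<le> 2 + 17/6 * t - 1/3 * t\<^sup>2 - 7/6 * t^3" using t2 t by linarith
    also have "\<dots> = P\<^sup>2"
      unfolding P2 by (simp add: power2_eq_square power3_eq_cube field_simps)
    finally show "(141/100 + 7/10 * t)\<^sup>2 \<le> P\<^sup>2" .
    show "0 \<le> P" using t by (simp add: P_def)
  qed
  moreover have "141/100 - 7/10 * t \<le> Q"
  proof (rule power2_le_imp_le)
    have "0 \<le> 51/100 * (t - 1/40)\<^sup>2" by simp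
    then show "(141/100 - 7/10 * t)\<^sup>2 \<le> Q\<^sup>2" unfolding Q2 using t
      by (simp add: power2_eq_square algebra_simps)
    show "0 \<le> Q" by (simp add: Q_def)
  qed
  ultimately have D: "141/50 \<le> P + Q" by simp
  have N0: "0 \<le> N" using t t2 by (simp add: N_def)
  have "(N / (141/50))\<^sup>2 \<le> 1 + log 2 (1 / t)"
  proof -
    \<comment> \<open>\<open>41/8 - 5/2 * t\<close> is the tangent at \<open>t = 1/2\<close> to the concave function \<open>N\<close>.\<close>
    have "0 \<le> (t - 1/2)\<^sup>2" by simp
    then have "N \<le> 41/8 - 5/2 * t" by (simp add: N_def power2_eq_square field_simps)
    then have "N\<^sup>2 \<le> (41/8 - 5/2 * t)\<^sup>2" using N0 by (intro power_mono) auto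
    also have "\<dots> = 1681/64 - 205/8 * t + 25/4 * t\<^sup>2"
      by (simp add: power2_eq_square field_simps)
    also have "\<dots> \<le> (141/50)\<^sup>2 * (86/25 - 72/25 * t)"
      using t t2(1) by (simp add: power2_eq_square[of "_ / _"])
    finally show ?thesis using b by (simp add: power_divide field_simps)
  qed
  then have S: "N / (141/50) \<le> sqrt (1 + log 2 (1 / t))" by (rule real_le_rsqrt)
  have "(P - Q) * (P + Q) = P\<^sup>2 - Q\<^sup>2" by (simp add: power2_eq_square algebra_simps)
  also have "\<dots> = t * N"
    unfolding P2 Q2 N_def by (simp add: power2_eq_square field_simps)
  finally have "P - Q = t * (N / (P + Q))" using D by (simp add: field_simps)
  also have "\<dots> \<le> t * (N / (141/50))"
    using D N0 t by (intro mult_left_mono divide_left_mono) auto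
  also have "\<dots> \<le> t * sqrt (1 + log 2 (1 / t))"
    using S t by (intro mult_left_mono) auto
  finally have "P \<le> t * sqrt (1 + log 2 (1 / t)) + Q" by simp
  moreover have "(1 + t) * sqrt (1 + log 2 (2 / (1 + t))) \<le> P"
    unfolding P_def using a t by (intro mult_left_mono) auto
  ultimately show ?thesis by (simp add: Q_def)
qed

text \<open>The second derivative of \<open>z * sqrt (1 + log 2 (1 / z))\<close> is at least \<open>-47/25\<close> on \<open>{1/2..1}\<close>, so adding
  \<open>47/50 * z\<^sup>2\<close> makes the function convex. The midpoint inequality for the sum then controls the
  failure of midpoint convexity by a multiple of the squared distance.\<close>
lemma profile_plus_square_convex:
  "convex_on {1/2..1} (\<lambda>z::real. z * sqrt (1 + log 2 (1/z)) + 47/50 * z\<^sup>2)"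
proof -
  define c where "c = 1 / (2 * ln (2::real))"
  define w where "w z = 1 + log 2 (1/z)" for z :: real
  have c: "0 < c" "c \<le> 3/4" using inverse_ln2_bounds by (auto simp: c_def)
  have w: "61/25 - 36/25 * z \<le> w z" "1 \<le> w z" if "z \<in> {1/2..1}" for z
    using log2_inverse_ge_linear[of z] that by (auto simp: w_def)
  have dw: "(w has_real_derivative - (2 * c / z)) (at z)" if "z \<in> {1/2..1}" for z
    unfolding w_def log_def using that
    by (auto intro!: derivative_eq_intros simp: c_def field_simps power2_eq_square)
  have "convex_on {1/2..1} (\<lambda>z. z * sqrt (w z) + 47/50 * z\<^sup>2)"
  proof (rule f''_ge0_imp_convex)
    fix z :: real assume z: "z \<in> {1/2..1}"
    have wz: "0 < w z" "0 < z" using w(2)[OF z] z by auto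
    have sq: "sqrt (w z) * sqrt (w z) = w z"
      "\<And>x. sqrt (w z) * (sqrt (w z) * x) = w z * x"
      using wz by (simp_all flip: mult.assoc)
    show "((\<lambda>z. z * sqrt (w z) + 47/50 * z\<^sup>2) has_real_derivative
        sqrt (w z) - c / sqrt (w z) + 47/25 * z) (at z)"
      using wz by (auto intro!: derivative_eq_intros dw[OF z] simp: field_simps)
    show "((\<lambda>z. sqrt (w z) - c / sqrt (w z) + 47/25 * z) has_real_derivative
        47/25 - (c / (z * sqrt (w z)) + c\<^sup>2 / (z * (w z * sqrt (w z))))) (at z)"
      using wz by (auto intro!: derivative_eq_intros dw[OF z] simp: field_simps power2_eq_square sq)
    \<comment> \<open>With the lower bound for \<open>w z\<close> inserted, both \<open>z * sqrt (w z)\<close> and \<open>z * w z\<close> are smallest at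
      \<open>z = 1/2\<close>; the constants \<open>131/200\<close> and \<open>43/50\<close> are these values, the first one rounded down.\<close>
    have r1: "131/200 \<le> z * sqrt (w z)"
    proof (rule power2_le_imp_le)
      have "0 \<le> (z - 1/2) * (1 - z) * z" "0 \<le> (z - 1/2)\<^sup>2" "1/2 \<le> z" using z by auto
      then have "z^3 \<le> 3/2 * z\<^sup>2 - 1/2 * z" "z - 1/4 \<le> z\<^sup>2" "1/2 \<le> z"
        by (simp_all add: power2_eq_square power3_eq_cube field_simps)
      then have "17161/40000 \<le> 61/25 * z\<^sup>2 - 36/25 * z^3" by linarith
      then have "(131/200)\<^sup>2 \<le> z\<^sup>2 * (61/25 - 36/25 * z)"
        by (simp add: power2_eq_square power3_eq_cube field_simps)
      also have "\<dots> \<le> (z * sqrt (w z))\<^sup>2"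
        using w(1)[OF z] wz by (simp add: power_mult_distrib)
      finally show "(131/200)\<^sup>2 \<le> (z * sqrt (w z))\<^sup>2" .
    qed (use wz in simp)
    have "0 \<le> (z - 1/2) * (1 - z)" "1/2 \<le> z" using z by auto
    then have "z\<^sup>2 \<le> 3/2 * z - 1/2" "1/2 \<le> z"
      by (simp_all add: power2_eq_square field_simps)
    then have "43/50 \<le> 61/25 * z - 36/25 * z\<^sup>2" by linarith
    also have "\<dots> = z * (61/25 - 36/25 * z)" by (simp add: power2_eq_square algebra_simps)
    also have "\<dots> \<le> z * w z" using w(1)[OF z] wz by simp
    finally have "43/50 * 1 \<le> z * w z * sqrt (w z)"
      using w(2)[OF z] by (intro mult_mono) auto
    then have r2: "43/50 \<le> z * (w z * sqrt (w z))" by (simp add: mult.assoc)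
    have "c / (z * sqrt (w z)) \<le> (3/4) / (131/200)"
      using r1 c by (intro frac_le) auto
    moreover have "c\<^sup>2 / (z * (w z * sqrt (w z))) \<le> (3/4)\<^sup>2 / (43/50)"
      using r2 c by (intro frac_le power_mono) auto
    ultimately show "0 \<le> 47/25 - (c / (z * sqrt (w z)) + c\<^sup>2 / (z * (w z * sqrt (w z))))"
      by (simp add: power2_eq_square)
  qed simp
  then show ?thesis by (simp add: w_def)
qed

text \<open>Near \<open>t = 1\<close> both sides agree to first order, so second-order information is needed. Midpoint
  convexity between \<open>t\<close> and \<open>1\<close> leaves the error \<open>47/100 * (1 - t)\<^sup>2\<close>, and for \<open>1 - t \<le> 1/2\<close> this is at
  most \<open>sqrt (1 + (1 - t)\<^sup>2) - 1\<close>.\<close>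
lemma two_point_unit_large:
  fixes t :: real
  assumes t: "1/2 \<le> t" "t \<le> 1"
  shows "(1 + t) * sqrt (1 + log 2 (2 / (1 + t))) \<le> t * sqrt (1 + log 2 (1 / t)) + sqrt (1 + (1 - t)\<^sup>2)"
proof -
  define m where "m = (1 + t) / 2"
  have "m * sqrt (1 + log 2 (1/m)) + 47/50 * m\<^sup>2
      \<le> 1/2 * (t * sqrt (1 + log 2 (1/t)) + 47/50 * t\<^sup>2) + 1/2 * (1 + 47/50)"
    using convex_onD[OF profile_plus_square_convex, of "1/2" t 1] t by (simp add: m_def add_divide_distrib add.commute)
  then have 1: "2 * m * sqrt (1 + log 2 (1/m)) \<le> t * sqrt (1 + log 2 (1/t)) + (1 + 47/100 * (1 - t)\<^sup>2)"
    by (simp add: m_def power2_eq_square field_simps)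
  define d where "d = (1 - t)\<^sup>2"
  have "d \<le> (1/2)\<^sup>2" unfolding d_def using t by (intro power_mono) auto
  moreover have "0 \<le> d" by (simp add: d_def)
  ultimately have "d * d \<le> d * (1/4)" by (intro mult_left_mono) (auto simp: power2_eq_square)
  with \<open>0 \<le> d\<close> have "(1 + 47/100 * d)\<^sup>2 \<le> 1 + d" by (simp add: power2_eq_square algebra_simps)
  then have "1 + 47/100 * d \<le> sqrt (1 + d)" by (rule real_le_rsqrt)
  moreover have "2 * m = 1 + t" "1 / m = 2 / (1 + t)" by (simp_all add: m_def)
  ultimately show ?thesis using 1 by (simp add: d_def)
qed

lemma two_point_unit:
  fixes t :: real
  assumes t: "0 < t" "t \<le> 1"
  shows "(1 + t) * sqrt (1 + log 2 (2 / (1 + t))) \<le> t * sqrt (1 + log 2 (1 / t)) + sqrt (1 + (1 - t)\<^sup>2)"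
  using two_point_unit_small[of t] two_point_unit_large[of t] t by linarith

lemma sqrt_triangle:
  fixes r d :: real
  shows "sqrt (r\<^sup>2 + d\<^sup>2) \<le> 1 + sqrt ((r - 1)\<^sup>2 + d\<^sup>2)"
proof -
  have "1 + Complex (r - 1) d = Complex r d" by (simp add: complex_eq_iff)
  then show ?thesis using norm_triangle_ineq[of 1 "Complex (r - 1) d"] by (simp add: complex_norm)
qed

text \<open>Write \<open>t = x / y\<close>, \<open>d = 1 - t\<close> and \<open>\<sigma> = 1 + log 2 (1 / y)\<close>. Dividing by \<open>y\<close> turns \<open>profile y\<close> into
  \<open>sqrt \<sigma> - 1\<close>, and the triangle inequality replaces \<open>sqrt ((sqrt \<sigma> - 1)\<^sup>2 + d\<^sup>2)\<close> by \<open>sqrt (\<sigma> + d\<^sup>2) - 1\<close>.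
  The linear terms now cancel, and what remains is the normalised inequality at scale \<open>\<sigma> \<ge> 1\<close>.\<close>
lemma profile_two_point:
  assumes x: "0 \<le> x" "x \<le> y" "y \<le> 1"
  shows "2 * profile ((x + y) / 2) \<le> profile x + sqrt ((profile y)\<^sup>2 + (y - x)\<^sup>2)"
proof (cases "y = 0")
  case True
  with x show ?thesis by (simp add: profile_def)
next
  case False
  then have y: "0 < y" using x by simp
  define t where "t = x / y"
  define \<sigma> where "\<sigma> = 1 + log 2 (1 / y)"
  define d where "d = 1 - t"
  have t: "0 \<le> t" "t \<le> 1" and x_eq: "x = t * y" using x y by (auto simp: t_def)
  have \<sigma>: "1 \<le> \<sigma>" using x y by (simp add: \<sigma>_def log_divide)
  have scaled: "(1 + t) * sqrt (\<sigma> + log 2 (2 / (1 + t)))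
      \<le> t * sqrt (\<sigma> + log 2 (1 / t)) + sqrt (\<sigma> + d\<^sup>2)"
  proof (cases "t = 0")
    case True
    then show ?thesis by (simp add: d_def)
  next
    case False
    then have "0 < t" using t by simp
    show ?thesis unfolding d_def
    proof (rule two_point_all_scales)
      show "0 \<le> log 2 (2 / (1 + t))" "0 \<le> log 2 (1 / t)" using \<open>0 < t\<close> t(2) by simp_all
    qed (use t \<sigma> two_point_unit[OF \<open>0 < t\<close> t(2)] in simp_all)
  qed
  have tri: "sqrt (\<sigma> + d\<^sup>2) \<le> 1 + sqrt ((sqrt \<sigma> - 1)\<^sup>2 + d\<^sup>2)"
    using sqrt_triangle[of "sqrt \<sigma>" d] \<sigma> by simp
  have m: "2 * profile ((x + y) / 2) = y * ((1 + t) * sqrt (\<sigma> + log 2 (2 / (1 + t))) - (1 + t))"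
  proof -
    have "x + y = y * (1 + t)" by (simp add: x_eq algebra_simps)
    then have "log 2 (1 / ((x + y) / 2)) + 1 = \<sigma> + log 2 (2 / (1 + t))"
      using y t by (simp add: \<sigma>_def log_mult log_divide)
    then have "profile ((x + y) / 2) = (x + y) / 2 * sqrt (\<sigma> + log 2 (2 / (1 + t))) - (x + y) / 2"
      by (simp only: profile_def)
    then show ?thesis using \<open>x + y = y * (1 + t)\<close> by (simp add: field_simps)
  qed
  have px: "profile x = y * (t * sqrt (\<sigma> + log 2 (1 / t)) - t)"
  proof (cases "t = 0")
    case True
    then show ?thesis by (simp add: profile_def x_eq)
  next
    case False
    then have "log 2 (1 / x) + 1 = \<sigma> + log 2 (1 / t)"
      using y t by (simp add: \<sigma>_def x_eq log_divide log_mult)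
    then show ?thesis by (simp add: profile_def x_eq algebra_simps)
  qed
  have py: "profile y = y * (sqrt \<sigma> - 1)"
    by (simp add: profile_def \<sigma>_def algebra_simps)
  have "(profile y)\<^sup>2 + (y - x)\<^sup>2 = y\<^sup>2 * ((sqrt \<sigma> - 1)\<^sup>2 + d\<^sup>2)"
    unfolding py by (simp add: x_eq d_def power2_eq_square algebra_simps)
  then have "sqrt ((profile y)\<^sup>2 + (y - x)\<^sup>2) = y * sqrt ((sqrt \<sigma> - 1)\<^sup>2 + d\<^sup>2)"
    using y by (simp add: real_sqrt_mult)
  moreover have "y * ((1 + t) * sqrt (\<sigma> + log 2 (2 / (1 + t))) - (1 + t))
     \<le> y * ((t * sqrt (\<sigma> + log 2 (1 / t)) - t) + sqrt ((sqrt \<sigma> - 1)\<^sup>2 + d\<^sup>2))"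
    using scaled tri y by (intro mult_left_mono) auto
  ultimately show ?thesis using m px by (simp add: algebra_simps)
qed

lemma profile_nonneg: "0 \<le> x \<Longrightarrow> x \<le> 1 \<Longrightarrow> 0 \<le> profile x"
  by (cases "x = 0") (simp_all add: profile_def log_divide mult_le_cancel_left1)

section \<open>Slices of the cube\<close>

definition slice :: "nat \<Rightarrow> nat \<Rightarrow> (nat \<Rightarrow> nat) set \<Rightarrow> (nat \<Rightarrow> nat) set" where
  "slice n i A = {x \<in> cube n. x(n := i) \<in> A}"

lemma finite_cube [simp]: "finite (cube n)" by (simp add: cube_def finite_PiE)

lemma cube_0: "cube 0 = {\<lambda>_. undefined}" by (simp add: cube_def)

lemma sum_cube_Suc:
  "(\<Sum>x\<in>cube (Suc n). f x) = (\<Sum>x\<in>cube n. f (x(n := 0)) + f (x(n := 1)))"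
proof -
  have eq: "cube (Suc n) = (\<lambda>(i, x). x(n := i)) ` ({0, 1} \<times> cube n)"
    by (simp add: cube_def lessThan_Suc PiE_insert_eq)
  have inj: "inj_on (\<lambda>(i, x). x(n := i)) ({0, 1} \<times> cube n)"
    unfolding cube_def using inj_combinator[of n "{..<n}" "\<lambda>_. {0, 1 :: nat}"] by simp
  have "(\<Sum>x\<in>cube (Suc n). f x) = (\<Sum>(i, x)\<in>{0, 1} \<times> cube n. f (x(n := i)))"
    unfolding eq by (subst sum.reindex[OF inj]) (simp add: comp_def case_prod_unfold)
  then show ?thesis by (simp flip: sum.cartesian_product add: sum.distrib)
qed

lemma cube_expectation_Suc:
  "cube_expectation (Suc n) f =
    (cube_expectation n (\<lambda>x. f (x(n := 0))) + cube_expectation n (\<lambda>x. f (x(n := 1)))) / 2"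
  by (simp add: cube_expectation_def sum_cube_Suc sum.distrib field_simps)

lemma cube_expectation_mono:
  "(\<And>x. x \<in> cube n \<Longrightarrow> f x \<le> g x) \<Longrightarrow> cube_expectation n f \<le> cube_expectation n g"
  by (simp add: cube_expectation_def divide_right_mono sum_mono)

lemma cube_expectation_cong:
  "(\<And>x. x \<in> cube n \<Longrightarrow> f x = g x) \<Longrightarrow> cube_expectation n f = cube_expectation n g"
  by (simp add: cube_expectation_def)

definition flip :: "nat \<Rightarrow> (nat \<Rightarrow> nat) \<Rightarrow> nat \<Rightarrow> nat" where
  "flip i x = x(i := 1 - x i)"

text \<open>Counting edges by their directions makes the induction on the dimension transparent: restricting
  to a slice removes exactly the last direction.\<close>
lemma edge_boundary_flip:
  assumes x: "x \<in> cube n" "x \<in> A"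
  shows "edge_boundary n A x = card {i \<in> {..<n}. flip i x \<notin> A}"
proof -
  have bit: "x i = 0 \<or> x i = 1" if "i < n" for i using x that by (auto simp: cube_def PiE_iff)
  have fl: "flip i x \<in> cube n" if "i < n" for i
    using x that by (auto simp: cube_def flip_def PiE_iff extensional_def)
  have adj: "cube_adj n x (flip i x)" if "i < n" for i
  proof -
    have "{j \<in> {..<n}. x j \<noteq> flip i x j} = {i}"
      using that bit[of i] by (auto simp: flip_def)
    then show ?thesis using x fl[OF that] by (simp add: cube_adj_def)
  qed
  have inj: "inj_on (\<lambda>i. flip i x) {i \<in> {..<n}. flip i x \<notin> A}"
  proof (rule inj_onI)
    fix i j assume ij: "i \<in> {i \<in> {..<n}. flip i x \<notin> A}" "flip i x = flip j x"
    show "i = j"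
    proof (rule ccontr)
      assume "i \<noteq> j"
      then have "1 - x i = x i" using fun_cong[OF ij(2), of i] by (simp add: flip_def)
      then show False using ij bit[of i] by auto
    qed
  qed
  have "{y \<in> cube n - A. cube_adj n x y} = (\<lambda>i. flip i x) ` {i \<in> {..<n}. flip i x \<notin> A}"
  proof (intro equalityI subsetI)
    fix y assume y: "y \<in> {y \<in> cube n - A. cube_adj n x y}"
    then obtain i where i: "{j \<in> {..<n}. x j \<noteq> y j} = {i}"
      by (auto simp: cube_adj_def card_1_singleton_iff)
    have diff: "j < n \<and> x j \<noteq> y j \<longleftrightarrow> j = i" for j using i by blast
    have "y = flip i x"
    proof
      fix j
      show "y j = flip i x j"
      proof (cases "j < n")
        case True
        then have "y j = 0 \<or> y j = 1" using y by (auto simp: cube_def PiE_iff)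
        then show ?thesis using True bit[OF True] diff[of j] by (cases "j = i") (auto simp: flip_def)
      next
        case False
        then have "j \<noteq> i" "y j = x j"
          using diff[of i] x y by (auto simp: cube_def PiE_iff extensional_def)
        then show ?thesis by (simp add: flip_def)
      qed
    qed
    then show "y \<in> (\<lambda>i. flip i x) ` {i \<in> {..<n}. flip i x \<notin> A}" using y i by auto
  qed (use fl adj in auto)
  then show ?thesis using x card_image[OF inj] by (simp add: edge_boundary_def)
qed

lemma edge_boundary_Suc:
  assumes x: "x \<in> cube n" and i: "i \<in> {0, 1}"
  shows "edge_boundary (Suc n) A (x(n := i)) =
    edge_boundary n (slice n i A) x + (if x \<in> slice n i A - slice n (1 - i) A then 1 else 0)"
proof (cases "x(n := i) \<in> A")
  case True
  have xS: "x(n := i) \<in> cube (Suc n)"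
    using x i by (auto simp: cube_def PiE_iff extensional_def less_Suc_eq)
  have fl: "flip j x \<in> cube n" if "j < n" for j
    using x that by (auto simp: cube_def flip_def PiE_iff extensional_def)
  have xA: "x \<in> slice n i A" using x True by (simp add: slice_def)
  have "{j \<in> {..<Suc n}. flip j (x(n := i)) \<notin> A} =
      {j \<in> {..<n}. flip j x \<notin> slice n i A} \<union> {j. j = n \<and> x \<notin> slice n (1 - i) A}" (is "_ = ?L \<union> ?N")
  proof -
    have "flip j (x(n := i)) = (flip j x)(n := i)" if "j < n" for j
      using that by (auto simp: flip_def)
    moreover have "flip n (x(n := i)) = x(n := 1 - i)" by (simp add: flip_def)
    ultimately show ?thesis using fl x by (auto simp: slice_def less_Suc_eq)
  qed
  moreover have "card (?L \<union> ?N) = card ?L + card ?N"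
    by (rule card_Un_disjoint) auto
  moreover have "card ?N = (if x \<in> slice n i A - slice n (1 - i) A then 1 else 0)"
    using xA by simp
  ultimately show ?thesis
    using edge_boundary_flip[OF xS True] edge_boundary_flip[OF x xA] by simp
next
  case False
  then show ?thesis by (simp add: edge_boundary_def slice_def)
qed

lemma cube_measure_Suc:
  "cube_measure (Suc n) A = (cube_measure n (slice n 0 A) + cube_measure n (slice n 1 A)) / 2"
  unfolding cube_measure_def cube_expectation_Suc
  by (simp add: cube_expectation_def slice_def indicator_def)

lemma cube_measure_bounds: "0 \<le> cube_measure n A" "cube_measure n A \<le> 1"
proof -
  have "card (cube n) = 2 ^ n" by (simp add: cube_def card_PiE numeral_2_eq_2)
  then have "(\<Sum>x\<in>cube n. indicat_real A x) \<le> 2 ^ n"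
    using sum_bounded_above[of "cube n" "indicat_real A" 1] by (simp add: indicator_def)
  then show "cube_measure n A \<le> 1" by (simp add: cube_measure_def cube_expectation_def)
qed (simp add: cube_measure_def cube_expectation_def sum_nonneg)

section \<open>The lower bound\<close>

text \<open>The triangle inequality for sums of the complex numbers with parts \<open>a x\<close> and \<open>b x\<close>.\<close>
lemma minkowski_sqrt:
  fixes a b :: "'a \<Rightarrow> real"
  shows "sqrt ((\<Sum>x\<in>S. a x)\<^sup>2 + (\<Sum>x\<in>S. b x)\<^sup>2) \<le> (\<Sum>x\<in>S. sqrt ((a x)\<^sup>2 + (b x)\<^sup>2))"
proof -
  have "Complex (\<Sum>x\<in>S. a x) (\<Sum>x\<in>S. b x) = (\<Sum>x\<in>S. Complex (a x) (b x))"
    by (simp add: complex_eq_iff)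
  then have "cmod (Complex (\<Sum>x\<in>S. a x) (\<Sum>x\<in>S. b x)) \<le> (\<Sum>x\<in>S. cmod (Complex (a x) (b x)))"
    by (simp only: norm_sum)
  then show ?thesis by (simp add: complex_norm)
qed

abbreviation half_boundary :: "nat \<Rightarrow> (nat \<Rightarrow> nat) set \<Rightarrow> real" where
  "half_boundary n A \<equiv> cube_expectation n (\<lambda>x. sqrt (real (edge_boundary n A x)))"

lemma half_boundary_nonneg: "0 \<le> half_boundary n A"
  by (simp add: cube_expectation_def sum_nonneg)

text \<open>The points of \<open>B - C\<close> gain one edge in the new direction. Since \<open>sqrt (h + 1)\<close> is the length of the
  vector with parts \<open>sqrt h\<close> and \<open>1\<close>, the Minkowski inequality combines the old half boundary with the measure of
  \<open>B - C\<close>, which is at least the difference of the measures.\<close>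
lemma half_boundary_extra:
  "sqrt ((half_boundary n B)\<^sup>2 + (max 0 (cube_measure n B - cube_measure n C))\<^sup>2)
    \<le> cube_expectation n (\<lambda>x. sqrt (real (edge_boundary n B x + (if x \<in> B - C then 1 else 0))))"
proof -
  let ?r = "\<lambda>x. sqrt (real (edge_boundary n B x))"
  let ?e = "\<lambda>x. indicat_real (B - C) x"
  have "max 0 (cube_measure n B - cube_measure n C) \<le> (\<Sum>x\<in>cube n. ?e x) / 2 ^ n"
  proof -
    have "(\<Sum>x\<in>cube n. indicat_real B x) - (\<Sum>x\<in>cube n. indicat_real C x) \<le> (\<Sum>x\<in>cube n. ?e x)"
      unfolding sum_subtractf[symmetric] by (intro sum_mono) (auto simp: indicator_def)
    then have "cube_measure n B - cube_measure n C \<le> (\<Sum>x\<in>cube n. ?e x) / 2 ^ n"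
      by (simp add: cube_measure_def cube_expectation_def diff_divide_distrib[symmetric] divide_right_mono)
    then show ?thesis by (simp add: sum_nonneg)
  qed
  then have "sqrt ((half_boundary n B)\<^sup>2 + (max 0 (cube_measure n B - cube_measure n C))\<^sup>2)
      \<le> sqrt ((half_boundary n B)\<^sup>2 + ((\<Sum>x\<in>cube n. ?e x) / 2 ^ n)\<^sup>2)"
    by (intro real_sqrt_le_mono add_left_mono power_mono) auto
  also have "\<dots> = sqrt ((\<Sum>x\<in>cube n. ?r x)\<^sup>2 + (\<Sum>x\<in>cube n. ?e x)\<^sup>2) / 2 ^ n"
    by (simp add: cube_expectation_def power_divide add_divide_distrib[symmetric] real_sqrt_divide)
  also have "\<dots> \<le> (\<Sum>x\<in>cube n. sqrt ((?r x)\<^sup>2 + (?e x)\<^sup>2)) / 2 ^ n"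
    by (intro divide_right_mono minkowski_sqrt) auto
  also have "\<dots> = cube_expectation n (\<lambda>x. sqrt (real (edge_boundary n B x + (if x \<in> B - C then 1 else 0))))"
    unfolding cube_expectation_def
    by (intro arg_cong2[where f = "(/)"] sum.cong) (auto simp: indicator_def)
  finally show ?thesis .
qed

text \<open>Induction on the dimension. The new edges are used only at the points of the larger of the
  two slices.\<close>
lemma half_boundary_ge_profile:
  assumes "A \<subseteq> cube n"
  shows "profile (cube_measure n A) \<le> half_boundary n A"
  using assms
proof (induction n arbitrary: A)
  case 0
  then have "A = {} \<or> A = cube 0" by (auto simp: cube_0)
  then have "cube_measure 0 A \<in> {0, 1}"
    by (auto simp: cube_measure_def cube_expectation_def cube_0)
  then have "profile (cube_measure 0 A) = 0" by (auto simp: profile_def)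
  then show ?case using half_boundary_nonneg[of 0 A] by simp
next
  case (Suc n)
  define F where "F B C = cube_expectation n
    (\<lambda>x. sqrt (real (edge_boundary n B x + (if x \<in> B - C then 1 else 0))))" for B C
  define A0 A1 where "A0 = slice n 0 A" and "A1 = slice n 1 A"
  have sub: "A0 \<subseteq> cube n" "A1 \<subseteq> cube n" by (auto simp: A0_def A1_def slice_def)
  have E: "half_boundary (Suc n) A = (F A0 A1 + F A1 A0) / 2"
    unfolding cube_expectation_Suc F_def A0_def A1_def
    by (simp add: edge_boundary_Suc cong: cube_expectation_cong)
  have M: "cube_measure (Suc n) A = (cube_measure n A0 + cube_measure n A1) / 2"
    by (simp add: cube_measure_Suc A0_def A1_def)
  have ordered: "2 * profile ((cube_measure n B + cube_measure n C) / 2) \<le> F B C + F C B"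
    if BC: "B \<subseteq> cube n" "C \<subseteq> cube n" "cube_measure n B \<le> cube_measure n C" for B C
  proof -
    let ?x = "cube_measure n B" and ?y = "cube_measure n C"
    have "2 * profile ((?x + ?y) / 2) \<le> profile ?x + sqrt ((profile ?y)\<^sup>2 + (?y - ?x)\<^sup>2)"
      using BC(3) cube_measure_bounds by (intro profile_two_point) auto
    also have "profile ?x \<le> F B C"
    proof -
      have "half_boundary n B \<le> F B C" unfolding F_def by (intro cube_expectation_mono) auto
      then show ?thesis using Suc.IH[OF BC(1)] by simp
    qed
    also have "sqrt ((profile ?y)\<^sup>2 + (?y - ?x)\<^sup>2) \<le> sqrt ((half_boundary n C)\<^sup>2 + (max 0 (?y - ?x))\<^sup>2)"
      using Suc.IH[OF BC(2)] profile_nonneg[OF cube_measure_bounds, of n C] BC(3)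
      by (intro real_sqrt_le_mono add_mono power_mono) auto
    also have "\<dots> \<le> F C B" unfolding F_def by (rule half_boundary_extra)
    finally show ?thesis by simp
  qed
  show ?case
    using ordered[of A0 A1] ordered[of A1 A0] sub unfolding E M
    by (cases "cube_measure n A0 \<le> cube_measure n A1") (auto simp: add.commute)
qed

section \<open>Sets of small boundary\<close>

abbreviation mean_boundary :: "nat \<Rightarrow> (nat \<Rightarrow> nat) set \<Rightarrow> real" where
  "mean_boundary n A \<equiv> cube_expectation n (\<lambda>x. real (edge_boundary n A x))"

lemma cube_expectation_add:
  "cube_expectation n (\<lambda>x. f x + g x) = cube_expectation n f + cube_expectation n g"
  by (simp add: cube_expectation_def sum.distrib add_divide_distrib)

lemma mean_boundary_Suc:
  "mean_boundary (Suc n) A =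
    (mean_boundary n (slice n 0 A) + cube_measure n (slice n 0 A - slice n 1 A) +
     (mean_boundary n (slice n 1 A) + cube_measure n (slice n 1 A - slice n 0 A))) / 2"
proof -
  have "cube_expectation n (\<lambda>x. real (edge_boundary (Suc n) A (x(n := i)))) =
      mean_boundary n (slice n i A) + cube_measure n (slice n i A - slice n (1 - i) A)"
    if "i \<in> {0, 1}" for i
  proof -
    have "cube_expectation n (\<lambda>x. real (edge_boundary (Suc n) A (x(n := i)))) =
      cube_expectation n (\<lambda>x. real (edge_boundary n (slice n i A) x)
        + indicat_real (slice n i A - slice n (1 - i) A) x)"
      by (intro cube_expectation_cong) (simp only: edge_boundary_Suc[OF _ that], simp add: indicator_def)
    then show ?thesis by (simp add: cube_expectation_add cube_measure_def)
  qed
  from this[of 0] this[of 1] show ?thesis by (simp add: cube_expectation_Suc)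
qed

definition join :: "nat \<Rightarrow> (nat \<Rightarrow> nat) set \<Rightarrow> (nat \<Rightarrow> nat) set \<Rightarrow> (nat \<Rightarrow> nat) set" where
  "join n B C = (\<lambda>x. x(n := 0)) ` B \<union> (\<lambda>x. x(n := 1)) ` C"

lemma join_subset: "B \<subseteq> cube n \<Longrightarrow> C \<subseteq> cube n \<Longrightarrow> join n B C \<subseteq> cube (Suc n)"
  by (force simp: join_def cube_def PiE_iff extensional_def less_Suc_eq)

lemma slice_join:
  assumes "B \<subseteq> cube n" "C \<subseteq> cube n"
  shows "slice n 0 (join n B C) = B" "slice n 1 (join n B C) = C"
proof -
  have inj: "x = y" if "x \<in> cube n" "y \<in> cube n" "x(n := i) = y(n := j)" for x y i j
  proof
    fix k
    show "x k = y k"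
      using that(1,2) fun_cong[OF that(3), of k] by (cases "k = n") (auto simp: cube_def PiE_iff extensional_def)
  qed
  have ij: "i = j" if "x(n := i) = y(n := j)" for x y :: "nat \<Rightarrow> nat" and i j
    using fun_cong[OF that, of n] by simp
  show "slice n 0 (join n B C) = B" "slice n 1 (join n B C) = C"
    using assms unfolding slice_def join_def by (auto dest: inj ij)
qed

lemma cube_measure_empty [simp]: "cube_measure n {} = 0"
  by (simp add: cube_measure_def cube_expectation_def)

lemma cube_measure_cube [simp]: "cube_measure n (cube n) = 1"
  by (simp add: cube_measure_eq_card) (simp add: cube_def card_PiE numeral_2_eq_2)

lemma cube_measure_compl:
  "A \<subseteq> cube n \<Longrightarrow> cube_measure n (cube n - A) = 1 - cube_measure n A"
proof -
  assume "A \<subseteq> cube n"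
  then have "cube_measure n (cube n) = cube_measure n A + cube_measure n (cube n - A)"
    unfolding cube_measure_def cube_expectation_add[symmetric]
    by (intro cube_expectation_cong) (auto simp: indicator_def)
  then show ?thesis by simp
qed

text \<open>The sets constructed are initial segments of a lexicographic order: a measure at most \<open>1/2\<close>
  is placed in one half of the cube, and a larger one fills that half and puts the rest into the other.
  For \<open>x\<close> the measure and \<open>e x\<close> the mean boundary this gives \<open>e x = e (2 * x) / 2 + x\<close> or
  \<open>e x = e (2 * x - 1) / 2 + (1 - x)\<close>. The first recursion preserves \<open>x * (log 2 (1 / x) + 2)\<close> exactly. The
  second one does not, but both preserve the bound \<open>1\<close>, which is below the other bound as
  soon as \<open>x \<ge> 1/2\<close>.\<close>
lemma exists_small_mean_boundary:
  assumes "m \<le> 2 ^ n"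
  shows "\<exists>A\<subseteq>cube n. cube_measure n A = real m / 2 ^ n \<and> mean_boundary n A \<le> 1 \<and>
    mean_boundary n A \<le> cube_measure n A * (log 2 (1 / cube_measure n A) + 2)"
  using assms
proof (induction n arbitrary: m)
  case 0
  show ?case
  proof (intro exI[of _ "if m = 0 then {} else cube 0"] conjI)
    show "cube_measure 0 (if m = 0 then {} else cube 0) = real m / 2 ^ 0"
      using 0 by (cases "m = 0") auto
  qed (auto simp: cube_expectation_def edge_boundary_def)
next
  case (Suc n)
  have empty: "mean_boundary n {} = 0" and full: "mean_boundary n (cube n) = 0"
    by (auto simp: cube_expectation_def edge_boundary_def)
  show ?case
  proof (cases "m \<le> 2 ^ n")
    case True
    from Suc.IH[OF True] obtain A where A: "A \<subseteq> cube n" "cube_measure n A = real m / 2 ^ n"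
      "mean_boundary n A \<le> 1"
      "mean_boundary n A \<le> cube_measure n A * (log 2 (1 / cube_measure n A) + 2)" by blast
    let ?J = "join n A {}" and ?x = "cube_measure n A"
    note sl = slice_join[OF A(1) empty_subsetI]
    have J: "cube_measure (Suc n) ?J = ?x / 2"
      unfolding cube_measure_Suc sl by simp
    have e: "mean_boundary (Suc n) ?J = (mean_boundary n A + ?x) / 2"
      unfolding mean_boundary_Suc sl empty by simp
    have "mean_boundary (Suc n) ?J \<le> ?x / 2 * (log 2 (1 / (?x / 2)) + 2)"
    proof (cases "?x = 0")
      case True
      then show ?thesis using A(4) e by simp
    next
      case False
      then have "0 < ?x" using cube_measure_bounds(1)[of n A] by simp
      then show ?thesis using A(4) e by (simp add: log_divide algebra_simps)
    qed
    moreover have "mean_boundary (Suc n) ?J \<le> 1"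
      using e A(3) cube_measure_bounds(2)[of n A] by simp
    moreover have "cube_measure (Suc n) ?J = real m / 2 ^ Suc n" using J A(2) by simp
    ultimately show ?thesis
      using join_subset[OF A(1) empty_subsetI] unfolding J[symmetric] by blast
  next
    case False
    then have "m - 2 ^ n \<le> 2 ^ n" using Suc.prems by simp
    from Suc.IH[OF this] obtain A where A: "A \<subseteq> cube n" "cube_measure n A = real (m - 2 ^ n) / 2 ^ n"
      "mean_boundary n A \<le> 1" by blast
    let ?J = "join n (cube n) A" and ?x = "cube_measure n A"
    note sl = slice_join[OF subset_refl A(1)]
    have J: "cube_measure (Suc n) ?J = (1 + ?x) / 2"
      unfolding cube_measure_Suc sl by simp
    have "A - cube n = {}" using A(1) by blast
    then have e: "mean_boundary (Suc n) ?J = (mean_boundary n A + (1 - ?x)) / 2"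
      unfolding mean_boundary_Suc sl full cube_measure_compl[OF A(1)] by (simp only: cube_measure_empty) simp
    have x: "0 \<le> ?x" "?x \<le> 1" by (rule cube_measure_bounds)+
    have e1: "mean_boundary (Suc n) ?J \<le> 1" using e x A(3) by simp
    also have "1 \<le> (1 + ?x) / 2 * 2" using x by simp
    also have "\<dots> \<le> (1 + ?x) / 2 * (log 2 (1 / ((1 + ?x) / 2)) + 2)"
      using x by (intro mult_left_mono) (auto simp: log_divide)
    finally have "mean_boundary (Suc n) ?J \<le> (1 + ?x) / 2 * (log 2 (1 / ((1 + ?x) / 2)) + 2)" .
    moreover have "(1 + ?x) / 2 = real m / 2 ^ Suc n"
      using A(2) False by (simp add: of_nat_diff field_simps)
    ultimately show ?thesis
      using join_subset[OF subset_refl A(1)] e1 unfolding J[symmetric] by blast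
  qed
qed

text \<open>Cauchy--Schwarz against the indicator of \<open>A\<close>, outside of which the boundary vanishes.\<close>
lemma half_boundary_le_mean:
  "half_boundary n A \<le> sqrt (cube_measure n A * mean_boundary n A)"
proof -
  have "(\<Sum>x\<in>cube n. sqrt (real (edge_boundary n A x)))
      = (\<Sum>x\<in>cube n. indicat_real A x * sqrt (real (edge_boundary n A x)))"
    by (intro sum.cong) (auto simp: indicator_def edge_boundary_def)
  then have "(\<Sum>x\<in>cube n. sqrt (real (edge_boundary n A x)))\<^sup>2
      \<le> (\<Sum>x\<in>cube n. (indicat_real A x)\<^sup>2) * (\<Sum>x\<in>cube n. (sqrt (real (edge_boundary n A x)))\<^sup>2)"
    using Cauchy_Schwarz_ineq_sum[of "indicat_real A" "\<lambda>x. sqrt (real (edge_boundary n A x))" "cube n"]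
    by simp
  moreover have "(indicat_real A x)\<^sup>2 = indicat_real A x" for x by (simp add: indicator_def)
  ultimately have "(half_boundary n A)\<^sup>2 \<le> cube_measure n A * mean_boundary n A"
    by (simp add: cube_measure_def cube_expectation_def power_divide divide_right_mono flip: power2_eq_square)
  then show ?thesis by (rule real_le_rsqrt)
qed

section \<open>Asymptotics\<close>

lemma B_half_bounds:
  assumes "x \<in> dyadic_unit \<inter> {0<..<1}"
  shows "profile x \<le> B_half x" "B_half x \<le> x * sqrt (log 2 (1 / x) + 2)"
proof -
  let ?S = "{half_boundary n A | n A. n \<ge> 1 \<and> A \<subseteq> cube n \<and> cube_measure n A = x}"
  from assms obtain k n where kn: "k \<le> 2 ^ n" "x = real k / 2 ^ n" and x: "0 < x"
    by (auto simp: dyadic_unit_def)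
  \<comment> \<open>One extra dimension makes the dimension positive even when \<open>n = 0\<close>.\<close>
  have "2 * k \<le> 2 ^ Suc n" using kn by simp
  from exists_small_mean_boundary[OF this] obtain A where A: "A \<subseteq> cube (Suc n)"
    "cube_measure (Suc n) A = x" "mean_boundary (Suc n) A \<le> x * (log 2 (1 / x) + 2)"
    using kn(2) by auto
  have mem: "half_boundary (Suc n) A \<in> ?S" using A by (intro CollectI exI conjI) auto
  have lower: "profile x \<le> z" if "z \<in> ?S" for z
    using that half_boundary_ge_profile by auto
  have "?S \<noteq> {}" using mem by (metis empty_iff)
  then show "profile x \<le> B_half x"
    unfolding B_half_def by (rule cInf_greatest) (rule lower)
  have "bdd_below ?S" using lower by (rule bdd_belowI)
  with mem have "B_half x \<le> half_boundary (Suc n) A"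
    unfolding B_half_def by (rule cInf_lower)
  also have "\<dots> \<le> sqrt (x * mean_boundary (Suc n) A)"
    using half_boundary_le_mean[of "Suc n" A] A(2) by simp
  also have "\<dots> \<le> sqrt (x\<^sup>2 * (log 2 (1 / x) + 2))"
    using A(3) x by (simp add: power2_eq_square mult.assoc)
  also have "\<dots> = x * sqrt (log 2 (1 / x) + 2)" using x by (simp add: real_sqrt_mult)
  finally show "B_half x \<le> x * sqrt (log 2 (1 / x) + 2)" .
qed

lemma B_half_asymptotics:
  "((\<lambda>x. B_half x / (x * sqrt (log 2 (1 / x)))) \<longlongrightarrow> 1) (at 0 within (dyadic_unit \<inter> {0<..<1}))"
proof (rule tendsto_sandwich)
  let ?F = "at (0::real) within (dyadic_unit \<inter> {0<..<1})"
  have le: "?F \<le> at_right 0" by (intro at_le) auto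
  have pos: "0 < x * sqrt (log 2 (1 / x))" if "x \<in> dyadic_unit \<inter> {0<..<1}" for x :: real
    using that by (auto simp: log_divide)
  have mem: "\<forall>\<^sub>F x in ?F. x \<in> dyadic_unit \<inter> {0<..<1}" by (simp add: eventually_at_filter)
  show "\<forall>\<^sub>F x in ?F. profile x / (x * sqrt (log 2 (1 / x))) \<le> B_half x / (x * sqrt (log 2 (1 / x)))"
    using mem
  proof eventually_elim
    case (elim x)
    show ?case by (rule divide_right_mono[OF B_half_bounds(1)[OF elim] less_imp_le[OF pos[OF elim]]])
  qed
  show "\<forall>\<^sub>F x in ?F. B_half x / (x * sqrt (log 2 (1 / x)))
      \<le> x * sqrt (log 2 (1 / x) + 2) / (x * sqrt (log 2 (1 / x)))"
    using mem
  proof eventually_elim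
    case (elim x)
    show ?case by (rule divide_right_mono[OF B_half_bounds(2)[OF elim] less_imp_le[OF pos[OF elim]]])
  qed
  have "((\<lambda>x::real. (x * sqrt (log 2 (1 / x) + 1) - x) / (x * sqrt (log 2 (1 / x)))) \<longlongrightarrow> 1) (at_right 0)"
    by real_asymp
  then show "((\<lambda>x. profile x / (x * sqrt (log 2 (1 / x)))) \<longlongrightarrow> 1) ?F"
    unfolding profile_def by (rule filterlim_mono[OF _ order_refl le])
  have "((\<lambda>x::real. x * sqrt (log 2 (1 / x) + 2) / (x * sqrt (log 2 (1 / x)))) \<longlongrightarrow> 1) (at_right 0)"
    by real_asymp
  then show "((\<lambda>x. x * sqrt (log 2 (1 / x) + 2) / (x * sqrt (log 2 (1 / x)))) \<longlongrightarrow> 1) ?F"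
    by (rule filterlim_mono[OF _ order_refl le])
qed

theorem theorem1p6:
  shows "(\<forall>n\<ge>1. \<forall>A. A \<subseteq> cube n \<longrightarrow>
            cube_expectation n (\<lambda>x. sqrt (real (edge_boundary n A x)))
              \<ge> cube_measure n A * sqrt (log 2 (1 / cube_measure n A) + 1) - cube_measure n A)
       \<and> ((\<lambda>x. B_half x / (x * sqrt (log 2 (1 / x)))) \<longlongrightarrow> 1)
            (at 0 within (dyadic_unit \<inter> {0<..<1}))"
  using half_boundary_ge_profile B_half_asymptotics by (simp add: profile_def)

end
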